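(* Let $(V_1,V_2)$ be a pair of doubly twisted isometries on a complex separable Hilbert space $\mathcal{H}$. Then there is a unique decomposition \[ \mathcal{H}=\mathcal{H}_{uu}\oplus\mathcal{H}_{us}\oplus\mathcal{H}_{su}\oplus\mathcal{H}_{ss}, \] where $\mathcal{H}_{uu},\mathcal{H}_{us},\mathcal{H}_{su},\mathcal{H}_{ss}$ are subspaces reducing $V_1$ and $V_2$ such that \begin{itemize} \item $V_1|_{\mathcal{H}_{uu}}$ and $V_2|_{\mathcal{H}_{uu}}$ are unitary operators, \item $V_1|_{\mathcal{H}_{us}}$ is unitary and $V_2|_{\mathcal{H}_{us}}$ is a shift, \item $V_1|_{\mathcal{H}_{su}}$ is a shift and $V_2|_{\mathcal{H}_{su}}$ is unitary, \item $V_1|_{\mathcal{H}_{ss}}$ and $V_2|_{\mathcal{H}_{ss}}$ are shifts. \end{itemize}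
   Context: Operators are bounded linear operators. A pair $(T_1,T_2)$ of operators on $\mathcal{H}$ is called doubly twisted if there is a unitary operator $U$ on $\mathcal{H}$ (a twist) such that $T_1T_2=UT_2T_1$, $T_1^*T_2=U^*T_2T_1^*$, and $T_iU=UT_i$ for $i=1,2$. A closed subspace $\mathcal{M}$ reduces $T$ if $T\mathcal{M}\subseteq\mathcal{M}$ and $T\mathcal{M}^\perp\subseteq\mathcal{M}^\perp$. An isometry $V$ on $\mathcal{H}$ is a (unilateral) shift if $\mathcal{H}=\bigoplus_{m\ge0}V^m\mathcal{W}$ for some closed subspace $\mathcal{W}$ with $V^k\mathcal{W}\perp V^\ell\mathcal{W}$ for $k\ne\ell$; equivalently $V^{*m}\to0$ in the strong operator topology. Any of the subspaces in a decomposition may be $\{0\}$. *)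

theory Defs
  imports "HOL-Analysis.Analysis"
begin

(* The complex inner product is linear in its first argument.  Every complex inner product
   space is a real one under the real part of the inner product, with the same norm; basing
   the class on real_inner gives it the library's norm and topology. *)
class complex_inner = real_inner +
  fixes scaleC :: "complex \<Rightarrow> 'a \<Rightarrow> 'a"  (infixr \<open>*\<^sub>C\<close> 75)
    and cinner :: "'a \<Rightarrow> 'a \<Rightarrow> complex"
  assumes scaleC_add_right: "a *\<^sub>C (x + y) = a *\<^sub>C x + a *\<^sub>C y"
    and scaleC_add_left: "(a + b) *\<^sub>C x = a *\<^sub>C x + b *\<^sub>C x"
    and scaleC_scaleC: "a *\<^sub>C b *\<^sub>C x = (a * b) *\<^sub>C x"
    and scaleR_scaleC: "r *\<^sub>R x = complex_of_real r *\<^sub>C x"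
    and cinner_commute: "cinner x y = cnj (cinner y x)"
    and cinner_add_left: "cinner (x + y) z = cinner x z + cinner y z"
    and cinner_scaleC_left: "cinner (a *\<^sub>C x) y = a * cinner x y"
    and inner_eq_Re_cinner: "inner x y = Re (cinner x y)"

class complex_hilbert_space = complex_inner + complete_space

global_interpretation complex_vector: vector_space "scaleC :: complex \<Rightarrow> 'a \<Rightarrow> 'a::complex_inner"
proof
  fix x :: 'a
  show "1 *\<^sub>C x = x"
    using scaleR_scaleC[of 1 x] by simp
qed (simp_all add: scaleC_add_right scaleC_add_left scaleC_scaleC)

definition closed_csubspace :: "'a::complex_inner set \<Rightarrow> bool" where
  "closed_csubspace M \<longleftrightarrow> complex_vector.subspace M \<and> closed M"

definition corthogonal :: "'a::complex_inner set \<Rightarrow> 'a set \<Rightarrow> bool" where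
  "corthogonal M N \<longleftrightarrow> (\<forall>x\<in>M. \<forall>y\<in>N. cinner x y = 0)"

definition corthogonal_compl :: "'a::complex_inner set \<Rightarrow> 'a set" where
  "corthogonal_compl M = {x. \<forall>y\<in>M. cinner x y = 0}"

(* Internal orthogonal (Hilbert) direct sum: the elements of M are exactly the norm-convergent
   sums of families with one member in each summand. *)
definition is_orthogonal_sum :: "'a::complex_inner set \<Rightarrow> 'i set \<Rightarrow> ('i \<Rightarrow> 'a set) \<Rightarrow> bool" where
  "is_orthogonal_sum M I E \<longleftrightarrow>
     (\<forall>i\<in>I. \<forall>j\<in>I. i \<noteq> j \<longrightarrow> corthogonal (E i) (E j)) \<and>
     M = {x. \<exists>f. (\<forall>i\<in>I. f i \<in> E i) \<and> (f has_sum x) I}"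

(* The notions below concern the restriction of T to M, regarded as an operator on the Hilbert
   space M, where M is a closed subspace.  M = UNIV gives the usual notions. *)

definition bounded_operator_on :: "'a::complex_inner set \<Rightarrow> ('a \<Rightarrow> 'a) \<Rightarrow> bool" where
  "bounded_operator_on M T \<longleftrightarrow>
     (\<forall>x\<in>M. T x \<in> M) \<and>
     (\<forall>x\<in>M. \<forall>y\<in>M. T (x + y) = T x + T y) \<and>
     (\<forall>a. \<forall>x\<in>M. T (a *\<^sub>C x) = a *\<^sub>C T x) \<and>
     (\<exists>K. \<forall>x\<in>M. norm (T x) \<le> K * norm x)"

(* For a bounded operator T on a Hilbert space M the operator chosen here exists and its values
   on M are unique, by the Riesz representation theorem; only these values are meaningful. *)
definition adjoint_on :: "'a::complex_inner set \<Rightarrow> ('a \<Rightarrow> 'a) \<Rightarrow> ('a \<Rightarrow> 'a)" where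
  "adjoint_on M T = (SOME S. (\<forall>y\<in>M. S y \<in> M) \<and> (\<forall>x\<in>M. \<forall>y\<in>M. cinner (T x) y = cinner x (S y)))"

abbreviation cadjoint :: "('a::complex_inner \<Rightarrow> 'a) \<Rightarrow> ('a \<Rightarrow> 'a)" where
  "cadjoint T \<equiv> adjoint_on UNIV T"

definition isometry_on :: "'a::complex_inner set \<Rightarrow> ('a \<Rightarrow> 'a) \<Rightarrow> bool" where
  "isometry_on M T \<longleftrightarrow> bounded_operator_on M T \<and> (\<forall>x\<in>M. norm (T x) = norm x)"

definition unitary_on :: "'a::complex_inner set \<Rightarrow> ('a \<Rightarrow> 'a) \<Rightarrow> bool" where
  "unitary_on M T \<longleftrightarrow> bounded_operator_on M T \<and>
     (\<forall>x\<in>M. adjoint_on M T (T x) = x \<and> T (adjoint_on M T x) = x)"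

definition shift_on :: "'a::complex_inner set \<Rightarrow> ('a \<Rightarrow> 'a) \<Rightarrow> bool" where
  "shift_on M T \<longleftrightarrow> isometry_on M T \<and>
     (\<exists>W. closed_csubspace W \<and> W \<subseteq> M \<and> is_orthogonal_sum M (UNIV :: nat set) (\<lambda>m. (T ^^ m) ` W))"

definition reduces :: "'a::complex_inner set \<Rightarrow> ('a \<Rightarrow> 'a) \<Rightarrow> bool" where
  "reduces M T \<longleftrightarrow> closed_csubspace M \<and> T ` M \<subseteq> M \<and>
     T ` corthogonal_compl M \<subseteq> corthogonal_compl M"

definition doubly_twisted :: "('a::complex_inner \<Rightarrow> 'a) \<Rightarrow> ('a \<Rightarrow> 'a) \<Rightarrow> bool" where
  "doubly_twisted T1 T2 \<longleftrightarrow> bounded_operator_on UNIV T1 \<and> bounded_operator_on UNIV T2 \<and>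
     (\<exists>U. unitary_on UNIV U \<and>
       T1 \<circ> T2 = U \<circ> T2 \<circ> T1 \<and>
       cadjoint T1 \<circ> T2 = cadjoint U \<circ> T2 \<circ> cadjoint T1 \<and>
       T1 \<circ> U = U \<circ> T1 \<and> T2 \<circ> U = U \<circ> T2)"

end

theory Submission
  imports Defs
begin

text \<open>
  For an isometry \<open>V\<close> with adjoint \<open>A\<close>, the operators \<open>Q m = V\<^sup>m A\<^sup>m\<close> are the orthogonal
  projections onto the decreasing ranges of the powers \<open>V\<^sup>m\<close>.  A decreasing sequence of
  projections converges strongly, because the squared distance between \<open>Q m x\<close> and \<open>Q n x\<close> is
  the difference of their squared norms.  Hence every vector is the sum of a vector fixed by all
  \<open>Q m\<close> and a vector with \<open>Q m x \<longlonglongrightarrow> 0\<close>: this is the Wold decomposition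
  (\<open>wold_decomposition\<close>) into a unitary part and a shift part, which are orthogonal complements of
  each other.  Moreover, \<open>V\<close> restricts to a unitary operator on a reducing subspace exactly if that
  subspace lies in the unitary part (\<open>unitary_on_iff\<close>), and to a shift exactly if it lies in the
  shift part (\<open>shift_on_iff\<close>).

  For a doubly twisted pair with twist \<open>U\<close>, two twists cancel: moving \<open>V2\<close> past \<open>m\<close>
  factors of the adjoint of \<open>V1\<close> produces the inverse of \<open>U\<^sup>m\<close>, and moving it past \<open>V1\<^sup>m\<close>
  produces \<open>U\<^sup>m\<close>.  So \<open>V2\<close> commutes with the
  projections of \<open>V1\<close>, and by symmetry (the pair with its members exchanged is doubly twisted with
  the adjoint of \<open>U\<close> as a twist) \<open>V1\<close> commutes with those of \<open>V2\<close>.  Both parts of either isometry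
  therefore reduce the other one, and applying the Wold decomposition of \<open>V2\<close> inside the two parts
  of \<open>V1\<close> gives the four summands as intersections.

  Uniqueness follows from the two equivalences: the summands of any decomposition of the required
  kind are contained in the four intersections, and an orthogonal sum of the whole space cannot be
  properly contained, summand by summand, in another one (\<open>orthogonal_sum_eq_of_subset\<close>).
\<close>

section \<open>Complex inner products and orthogonal complements\<close>

lemma cinner_add_right: "cinner x (y + z) = cinner x y + cinner x z"
  by (metis cinner_commute cinner_add_left complex_cnj_add)

lemma cinner_scaleC_right: "cinner x (a *\<^sub>C y) = cnj a * cinner x y"
  by (metis cinner_commute cinner_scaleC_left complex_cnj_mult)

lemma cinner_zero_left [simp]: "cinner 0 y = 0"
  using cinner_add_left[of 0 0 y] by simp

lemma cinner_zero_right [simp]: "cinner x 0 = 0"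
  using cinner_add_right[of x 0 0] by simp

lemma cinner_diff_left: "cinner (x - y) z = cinner x z - cinner y z"
  using cinner_add_left[of "x - y" y z] by simp

lemma cinner_diff_right: "cinner x (y - z) = cinner x y - cinner x z"
  using cinner_add_right[of x "y - z" z] by simp

lemma cinner_eq_0_commute: "cinner x y = 0 \<longleftrightarrow> cinner y x = 0"
  by (metis cinner_commute complex_cnj_zero)

text \<open>Expressing the complex inner product by the real one transfers the continuity of the latter.\<close>

lemma cinner_eq_Complex: "cinner x y = Complex (inner x y) (inner x (\<i> *\<^sub>C y))"
  by (simp add: complex_eq_iff inner_eq_Re_cinner cinner_scaleC_right)

lemma cinner_self: "cinner x x = complex_of_real ((norm x)\<^sup>2)"
proof (rule complex_eqI)
  show "Re (cinner x x) = Re (complex_of_real ((norm x)\<^sup>2))"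
    by (simp add: inner_eq_Re_cinner[symmetric] power2_norm_eq_inner)
  show "Im (cinner x x) = Im (complex_of_real ((norm x)\<^sup>2))"
    using arg_cong[OF cinner_commute[of x x], of Im] by simp
qed

lemma cinner_self_eq_0: "cinner x x = 0 \<longleftrightarrow> x = 0"
  by (simp add: cinner_self)

lemma cinner_ext: "(\<And>z. cinner x z = cinner y z) \<Longrightarrow> x = y"
  using cinner_self_eq_0[of "x - y"] by (simp add: cinner_diff_left)

lemma cinner_ext_right: "(\<And>z. cinner z x = cinner z y) \<Longrightarrow> x = y"
  using cinner_self_eq_0[of "x - y"] by (simp add: cinner_diff_right)

lemma tendsto_cinner_left:
  "(f \<longlongrightarrow> l) F \<Longrightarrow> ((\<lambda>n. cinner (f n) y) \<longlongrightarrow> cinner l y) F"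
  unfolding cinner_eq_Complex by (intro tendsto_Complex tendsto_inner tendsto_const)

lemma tendsto_cinner_right:
  "(f \<longlongrightarrow> l) F \<Longrightarrow> ((\<lambda>n. cinner y (f n)) \<longlongrightarrow> cinner y l) F"
  unfolding cinner_commute[of y] by (intro tendsto_cnj tendsto_cinner_left)

lemma cinner_sum_left: "cinner (sum f F) y = (\<Sum>i\<in>F. cinner (f i) y)"
  by (induction F rule: infinite_finite_induct) (auto simp: cinner_add_left)

lemma has_sum_cinner_left:
  "(f has_sum x) I \<Longrightarrow> ((\<lambda>i. cinner (f i) y) has_sum cinner x y) I"
  unfolding has_sum_def using tendsto_cinner_left[of "sum f" x _ y] by (simp add: cinner_sum_left)

lemma closed_cinner_kernel:
  assumes "bounded_linear T"
  shows "closed {x. cinner (T x) y = 0}"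
  unfolding closed_sequential_limits
proof safe
  fix X l assume X: "\<forall>n. X n \<in> {x. cinner (T x) y = 0}" "X \<longlonglongrightarrow> l"
  have "(\<lambda>n. cinner (T (X n)) y) \<longlonglongrightarrow> cinner (T l) y"
    by (intro tendsto_cinner_left bounded_linear.tendsto[OF assms] X(2))
  then show "cinner (T l) y = 0"
    using X(1) by (simp add: LIMSEQ_const_iff)
qed

lemma closed_csubspace_compl: "closed_csubspace (corthogonal_compl M)"
proof -
  have "complex_vector.subspace (corthogonal_compl M)"
    unfolding complex_vector.subspace_def corthogonal_compl_def
    by (auto simp: cinner_add_left cinner_scaleC_left)
  moreover have "corthogonal_compl M = (\<Inter>y\<in>M. {x. cinner x y = 0})"
    by (auto simp: corthogonal_compl_def)
  then have "closed (corthogonal_compl M)"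
    by (auto intro!: closed_INT closed_cinner_kernel bounded_linear_ident)
  ultimately show ?thesis by (simp add: closed_csubspace_def)
qed

lemma closed_csubspace_Int:
  "closed_csubspace M \<Longrightarrow> closed_csubspace N \<Longrightarrow> closed_csubspace (M \<inter> N)"
  by (auto simp: closed_csubspace_def complex_vector.subspace_inter)

lemma closed_csubspace_add: "closed_csubspace M \<Longrightarrow> x \<in> M \<Longrightarrow> y \<in> M \<Longrightarrow> x + y \<in> M"
  by (auto simp: closed_csubspace_def complex_vector.subspace_add)

lemma closed_csubspace_diff: "closed_csubspace M \<Longrightarrow> x \<in> M \<Longrightarrow> y \<in> M \<Longrightarrow> x - y \<in> M"
  by (auto simp: closed_csubspace_def complex_vector.subspace_diff)

lemma closed_csubspace_zero: "closed_csubspace M \<Longrightarrow> 0 \<in> M"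
  by (auto simp: closed_csubspace_def complex_vector.subspace_0)

lemma closed_csubspace_scale: "closed_csubspace M \<Longrightarrow> x \<in> M \<Longrightarrow> a *\<^sub>C x \<in> M"
  by (auto simp: closed_csubspace_def complex_vector.subspace_scale)

lemma closed_csubspace_sum:
  "closed_csubspace M \<Longrightarrow> (\<And>i. i \<in> F \<Longrightarrow> f i \<in> M) \<Longrightarrow> sum f F \<in> M"
  by (auto simp: closed_csubspace_def complex_vector.subspace_sum)

lemma closed_csubspace_limit:
  assumes "closed_csubspace M" "(f \<longlongrightarrow> x) F" "F \<noteq> bot" "\<And>i. f i \<in> M"
  shows "x \<in> M"
  using assms by (intro Lim_in_closed_set[of M f F]) (auto simp: closed_csubspace_def)

lemma closed_csubspace_has_sum:
  assumes "closed_csubspace M" "(f has_sum x) I" "\<And>i. i \<in> I \<Longrightarrow> f i \<in> M"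
  shows "x \<in> M"
proof -
  have "\<forall>\<^sub>F F in finite_subsets_at_top I. sum f F \<in> M"
    using assms by (intro eventually_finite_subsets_at_top_weakI closed_csubspace_sum) auto
  then show ?thesis
    using assms(1,2) unfolding has_sum_def closed_csubspace_def
    by (auto intro: Lim_in_closed_set)
qed

section \<open>Orthogonal projection, Riesz representation and adjoints\<close>

text \<open>The parallelogram law, arranged so that two nearly closest points \<open>y\<close>, \<open>z\<close> of a subspace are seen to
  be close to each other: their midpoint is not much closer to \<open>x\<close> than they are.\<close>

lemma parallelogram_midpoint:
  fixes x y z :: "'a::real_inner"
  shows "(norm (y - z))\<^sup>2 = 2 * (norm (x - y))\<^sup>2 + 2 * (norm (x - z))\<^sup>2
           - 4 * (norm (x - (1/2) *\<^sub>R (y + z)))\<^sup>2"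
  by (simp add: power2_norm_eq_inner inner_simps inner_commute algebra_simps)

text \<open>A minimizing sequence for the distance to \<open>x\<close> is Cauchy by the parallelogram law, so by
  completeness there is a closest point \<open>p\<close>.  Minimality makes \<open>x - p\<close> orthogonal to \<open>M\<close> for the
  real inner product, and since \<open>M\<close> is closed under multiplication by \<open>\<i>\<close>, also for the complex one.\<close>

lemma orthogonal_projection_exists:
  fixes M :: "'a::complex_hilbert_space set"
  assumes M: "closed_csubspace M"
  obtains p where "p \<in> M" "x - p \<in> corthogonal_compl M"
proof -
  define d where "d = (INF y\<in>M. (norm (x - y))\<^sup>2)"
  have bdd: "bdd_below ((\<lambda>y. (norm (x - y))\<^sup>2) ` M)"
    by (rule bdd_belowI2[of _ 0]) simp
  have ne: "M \<noteq> {}" using closed_csubspace_zero[OF M] by auto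
  have d_le: "d \<le> (norm (x - y))\<^sup>2" if "y \<in> M" for y
    unfolding d_def by (rule cINF_lower[OF bdd that])
  have "\<exists>y\<in>M. (norm (x - y))\<^sup>2 < d + inverse (real (Suc n))" for n
    using cINF_less_iff[OF ne bdd, of "d + inverse (real (Suc n))"] by (simp add: d_def)
  then obtain Y where Y: "\<And>n. Y n \<in> M"
    and Yd: "\<And>n. (norm (x - Y n))\<^sup>2 < d + inverse (real (Suc n))" by metis
  have "Cauchy Y"
  proof (rule metric_CauchyI)
    fix e :: real assume e: "0 < e"
    obtain N where N: "inverse (real (Suc N)) < e\<^sup>2 / 4"
      using reals_Archimedean[of "e\<^sup>2 / 4"] e by auto
    show "\<exists>N. \<forall>m\<ge>N. \<forall>n\<ge>N. dist (Y m) (Y n) < e"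
    proof (intro exI[of _ N] allI impI)
      fix m n assume mn: "N \<le> m" "N \<le> n"
      have "(1/2) *\<^sub>R (Y m + Y n) \<in> M"
        unfolding scaleR_scaleC by (intro closed_csubspace_scale closed_csubspace_add M Y)
      note d_le[OF this]
      moreover have "inverse (real (Suc m)) \<le> inverse (real (Suc N))"
        "inverse (real (Suc n)) \<le> inverse (real (Suc N))"
        using mn by (auto simp: field_simps)
      ultimately have "(norm (Y m - Y n))\<^sup>2 < e\<^sup>2"
        using parallelogram_midpoint[of "Y m" "Y n" x] Yd[of m] Yd[of n] N by linarith
      then show "dist (Y m) (Y n) < e"
        using e by (simp add: dist_norm power_less_imp_less_base)
    qed
  qed
  then obtain p where p: "Y \<longlonglongrightarrow> p"
    using Cauchy_convergent convergent_def by blast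
  have pM: "p \<in> M"
    by (rule closed_csubspace_limit[OF M p _ Y]) simp
  have "(\<lambda>n. (norm (x - Y n))\<^sup>2) \<longlonglongrightarrow> (norm (x - p))\<^sup>2"
    by (intro tendsto_intros p)
  moreover have "(\<lambda>n. d + inverse (real (Suc n))) \<longlonglongrightarrow> d + 0"
    by (intro tendsto_intros LIMSEQ_inverse_real_of_nat)
  ultimately have pd: "(norm (x - p))\<^sup>2 \<le> d"
    using Yd by (intro LIMSEQ_le[where X = "\<lambda>n. (norm (x - Y n))\<^sup>2"]) (auto intro: less_imp_le)
  have closest: "\<forall>z\<in>M. dist x p \<le> dist x z"
    using order_trans[OF pd d_le] by (auto simp: dist_norm intro: power2_le_imp_le)
  have conv: "convex M"
    unfolding convex_def scaleR_scaleC
    by (auto intro!: closed_csubspace_add closed_csubspace_scale M)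
  have cl: "closed M" using M by (simp add: closed_csubspace_def)
  have real_orth: "inner (x - p) y = 0" if y: "y \<in> M" for y
  proof -
    have "inner (x - p) ((p + y) - p) \<le> 0"
      by (rule any_closest_point_dot[OF conv cl pM _ closest]) (intro closed_csubspace_add M pM y)
    moreover have "inner (x - p) ((p - y) - p) \<le> 0"
      by (rule any_closest_point_dot[OF conv cl pM _ closest]) (intro closed_csubspace_diff M pM y)
    ultimately show ?thesis by simp
  qed
  have "x - p \<in> corthogonal_compl M"
    by (simp add: corthogonal_compl_def cinner_eq_Complex real_orth closed_csubspace_scale[OF M]
        complex_eq_iff)
  with pM show thesis by (rule that)
qed

lemma bounded_operator_bounded_linear:
  assumes "bounded_operator_on UNIV T"
  shows "bounded_linear T"
proof -
  obtain K where K: "\<And>x. norm (T x) \<le> K * norm x"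
    using assms by (auto simp: bounded_operator_on_def)
  show ?thesis
    using assms K
    by (intro bounded_linear_intro[where K = K])
      (auto simp: bounded_operator_on_def scaleR_scaleC mult.commute)
qed

text \<open>The Riesz representation theorem for the functional sending \<open>x\<close> to \<open>cinner (T x) y\<close>: if the
  functional is nonzero, a suitable multiple of a nonzero vector orthogonal to its kernel
  represents it.\<close>

lemma adjoint_vector_exists:
  fixes T :: "'a::complex_hilbert_space \<Rightarrow> 'a"
  assumes T: "bounded_operator_on UNIV T"
  shows "\<exists>z. \<forall>x. cinner (T x) y = cinner x z"
proof (cases "\<forall>x. cinner (T x) y = 0")
  case True
  then show ?thesis by (intro exI[of _ 0]) simp
next
  case False
  define N where "N = {x. cinner (T x) y = 0}"
  have add: "T (a + b) = T a + T b" and scale: "T (c *\<^sub>C a) = c *\<^sub>C T a" for a b c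
    using T by (auto simp: bounded_operator_on_def)
  have zero: "T 0 = 0" using add[of 0 0] by simp
  have "closed N"
    unfolding N_def by (intro closed_cinner_kernel bounded_operator_bounded_linear T)
  then have N: "closed_csubspace N"
    unfolding closed_csubspace_def complex_vector.subspace_def
    by (auto simp: N_def add scale zero cinner_add_left cinner_scaleC_left)
  from False obtain w where w: "cinner (T w) y \<noteq> 0" by auto
  obtain p where p: "p \<in> N" "w - p \<in> corthogonal_compl N"
    using orthogonal_projection_exists[OF N] .
  define q where "q = w - p"
  have "T w = T q + T p" using add[of q p] by (simp add: q_def)
  then have Tq: "cinner (T q) y \<noteq> 0"
    using w p(1) by (auto simp: N_def cinner_add_left)
  then have q0: "cinner q q \<noteq> 0" using zero by (auto simp: cinner_self_eq_0)
  have "cinner (T x) y = cinner x (cnj (cinner (T q) y / cinner q q) *\<^sub>C q)" for x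
  proof -
    \<comment> \<open>the multiple of \<open>q\<close> that has to be removed from \<open>x\<close> to land in the kernel\<close>
    define c where "c = cinner (T x) y / cinner (T q) y"
    have "T x = T (x - c *\<^sub>C q) + c *\<^sub>C T q"
      using add[of "x - c *\<^sub>C q" "c *\<^sub>C q"] by (simp add: scale)
    then have "cinner (T x) y = cinner (T (x - c *\<^sub>C q)) y + c * cinner (T q) y"
      by (simp add: cinner_add_left cinner_scaleC_left)
    then have "x - c *\<^sub>C q \<in> N" using Tq by (simp add: N_def c_def)
    then have "cinner (x - c *\<^sub>C q) q = 0"
      using p(2) cinner_eq_0_commute by (auto simp: q_def corthogonal_compl_def)
    then have "cinner x q = c * cinner q q"
      by (simp add: cinner_diff_left cinner_scaleC_left)
    then show ?thesis using Tq q0 by (simp add: cinner_scaleC_right c_def)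
  qed
  then show ?thesis by blast
qed

lemma cinner_cadjoint:
  fixes T :: "'a::complex_hilbert_space \<Rightarrow> 'a"
  assumes "bounded_operator_on UNIV T"
  shows "cinner (T x) y = cinner x (cadjoint T y)"
proof -
  have "\<forall>y. \<exists>z. \<forall>x. cinner (T x) y = cinner x z"
    using adjoint_vector_exists[OF assms] by blast
  from choice[OF this] obtain S where "\<forall>y x. cinner (T x) y = cinner x (S y)" ..
  then have "\<exists>S. (\<forall>y\<in>UNIV. S y \<in> UNIV) \<and> (\<forall>x\<in>UNIV. \<forall>y\<in>UNIV. cinner (T x) y = cinner x (S y))"
    by (intro exI[of _ S]) simp
  from conjunct2[OF someI_ex[OF this], folded adjoint_on_def] show ?thesis
    by (elim ballE) simp_all
qed

text \<open>On a closed subspace the values of an adjoint are determined, so the operator chosen by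
  \<open>adjoint_on\<close> agrees with any given candidate.\<close>

lemma adjoint_on_eqI:
  assumes M: "closed_csubspace M" and S: "\<And>y. y \<in> M \<Longrightarrow> S y \<in> M"
    and adj: "\<And>x y. x \<in> M \<Longrightarrow> y \<in> M \<Longrightarrow> cinner (T x) y = cinner x (S y)" and y: "y \<in> M"
  shows "adjoint_on M T y = S y"
proof -
  define R where "R = adjoint_on M T"
  have "\<exists>S. (\<forall>y\<in>M. S y \<in> M) \<and> (\<forall>x\<in>M. \<forall>y\<in>M. cinner (T x) y = cinner x (S y))"
    using S adj by blast
  note R' = someI_ex[OF this, folded adjoint_on_def, folded R_def]
  have R: "R y \<in> M" "\<And>x. x \<in> M \<Longrightarrow> cinner (T x) y = cinner x (R y)"
    by (rule bspec[OF conjunct1[OF R'] y]) (rule bspec[OF bspec[OF conjunct2[OF R']] y])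
  have "R y - S y \<in> M" by (intro closed_csubspace_diff M S y R)
  then have "cinner (R y - S y) (R y - S y) = 0"
    using R(2) adj y by (simp add: cinner_diff_right)
  then show ?thesis by (simp add: cinner_self_eq_0 R_def)
qed

lemma adjoint_commute:
  assumes "\<And>x y. cinner (S x) y = cinner x (S' y)" and "\<And>x y. cinner (T x) y = cinner x (T' y)"
    and "\<And>x. S (T x) = T (S x)"
  shows "S' (T' x) = T' (S' x)"
proof (rule cinner_ext_right)
  fix z
  show "cinner z (S' (T' x)) = cinner z (T' (S' x))"
    by (simp only: assms(1,2)[symmetric] assms(3))
qed

section \<open>Orthogonal series\<close>

text \<open>For an orthogonal series, ordinary convergence already gives unconditional convergence: each
  term is the projection of \<open>x\<close> onto its direction, so enlarging a finite set of indices can only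
  decrease the distance of the partial sum from \<open>x\<close>.\<close>

lemma orthogonal_series_has_sum:
  fixes f :: "nat \<Rightarrow> 'a::real_inner"
  assumes orth: "\<And>i j. i \<noteq> j \<Longrightarrow> inner (f i) (f j) = 0" and lim: "f sums x"
  shows "(f has_sum x) UNIV"
proof -
  have coeff: "inner x (f j) = inner (f j) (f j)" for j
  proof -
    have "(\<lambda>i. inner (f i) (f j)) sums inner x (f j)"
      by (rule bounded_linear.sums[OF bounded_linear_inner_left lim])
    moreover have "(\<lambda>i. inner (f i) (f j)) sums (\<Sum>i\<in>{j}. inner (f i) (f j))"
      by (rule sums_finite) (auto simp: orth)
    ultimately show ?thesis by (auto dest: sums_unique2)
  qed
  have residual: "inner (x - sum f F) (f j) = 0" if "finite F" "j \<in> F" for F j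
  proof -
    have "inner (sum f F) (f j) = (\<Sum>i\<in>F. if i = j then inner (f j) (f j) else 0)"
      unfolding inner_sum_left by (rule sum.cong) (auto simp: orth)
    then show ?thesis using that by (simp add: inner_diff_left coeff)
  qed
  have mono: "norm (x - sum f F) \<le> norm (x - sum f E)" if F: "finite F" "E \<subseteq> F" for E F
  proof -
    have "sum f F = sum f (F - E) + sum f E"
      by (rule sum.subset_diff[OF F(2,1)])
    then have split: "x - sum f E = (x - sum f F) + sum f (F - E)" by simp
    have "inner (x - sum f F) (sum f (F - E)) = 0"
      unfolding inner_sum_right by (rule sum.neutral) (use residual F in blast)
    then have "(norm (x - sum f E))\<^sup>2 = (norm (x - sum f F))\<^sup>2 + (norm (sum f (F - E)))\<^sup>2"
      unfolding split power2_norm_eq_inner by (simp add: inner_add inner_commute)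
    then have "(norm (x - sum f F))\<^sup>2 \<le> (norm (x - sum f E))\<^sup>2"
      using zero_le_power2[of "norm (sum f (F - E))"] by linarith
    then show ?thesis by (rule power2_le_imp_le) (rule norm_ge_zero)
  qed
  show ?thesis
    unfolding has_sum_def tendsto_iff eventually_finite_subsets_at_top
  proof (intro allI impI)
    fix e :: real assume "0 < e"
    then obtain n where "dist (sum f {..<n}) x < e"
      using lim unfolding sums_def lim_sequentially by blast
    then have n: "norm (x - sum f {..<n}) < e" by (simp add: dist_norm norm_minus_commute)
    show "\<exists>X. finite X \<and> X \<subseteq> UNIV \<and>
        (\<forall>Y. finite Y \<and> X \<subseteq> Y \<and> Y \<subseteq> UNIV \<longrightarrow> dist (sum f Y) x < e)"
    proof (intro exI[of _ "{..<n}"] conjI allI impI)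
      fix Y :: "nat set" assume "finite Y \<and> {..<n} \<subseteq> Y \<and> Y \<subseteq> UNIV"
      then have "norm (x - sum f Y) \<le> norm (x - sum f {..<n})" by (intro mono) auto
      then show "dist (sum f Y) x < e"
        using n by (simp add: dist_norm norm_minus_commute[of _ x])
    qed auto
  qed
qed

lemma is_orthogonal_sum_orthogonal:
  "is_orthogonal_sum M I E \<Longrightarrow> i \<in> I \<Longrightarrow> j \<in> I \<Longrightarrow> i \<noteq> j \<Longrightarrow> corthogonal (E i) (E j)"
  by (simp add: is_orthogonal_sum_def)

lemma is_orthogonal_sum_expansion:
  assumes "is_orthogonal_sum M I E" "x \<in> M"
  shows "\<exists>f. (\<forall>i\<in>I. f i \<in> E i) \<and> (f has_sum x) I"
proof -
  have "M = {x. \<exists>f. (\<forall>i\<in>I. f i \<in> E i) \<and> (f has_sum x) I}"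
    using assms(1) unfolding is_orthogonal_sum_def by (rule conjunct2)
  from equalityD1[OF this, THEN subsetD, OF assms(2)] show ?thesis by (rule CollectD)
qed

text \<open>Expand \<open>x\<close> in \<open>F i\<close> along the smaller summands.  All components except the one in \<open>E i\<close> are
  orthogonal to \<open>F i\<close>, so the difference of \<open>x\<close> and its component in \<open>E i\<close> lies in \<open>F i\<close> and is
  orthogonal to it.\<close>

lemma orthogonal_sum_eq_of_subset:
  assumes E: "is_orthogonal_sum UNIV I E" and F: "is_orthogonal_sum UNIV I F"
    and le: "\<And>i. i \<in> I \<Longrightarrow> E i \<subseteq> F i" and sub: "\<And>i. i \<in> I \<Longrightarrow> closed_csubspace (F i)"
    and i: "i \<in> I"
  shows "E i = F i"
proof
  show "F i \<subseteq> E i"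
  proof
    fix x assume x: "x \<in> F i"
    obtain f where f: "\<And>j. j \<in> I \<Longrightarrow> f j \<in> E j" and sum: "(f has_sum x) I"
      using is_orthogonal_sum_expansion[OF E UNIV_I, of x] by blast
    have fi: "f i \<in> F i" using f[OF i] le[OF i] by blast
    have "cinner x y = cinner (f i) y" if y: "y \<in> F i" for y
    proof -
      have "cinner (f j) y = 0" if "j \<in> I" "j \<noteq> i" for j
      proof -
        have "corthogonal (F j) (F i)"
          by (rule is_orthogonal_sum_orthogonal[OF F that(1) i that(2)])
        moreover have "f j \<in> F j" using f[OF that(1)] le[OF that(1)] by blast
        ultimately show ?thesis using y unfolding corthogonal_def by blast
      qed
      then have "((\<lambda>j. cinner (f j) y) has_sum cinner (f i) y) I"
        using i by (intro has_sum_finite_neutralI[of "{i}"]) auto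
      with has_sum_cinner_left[OF sum] show ?thesis by (rule has_sum_unique)
    qed
    then have "cinner (x - f i) (x - f i) = 0"
      using closed_csubspace_diff[OF sub[OF i] x fi] by (simp add: cinner_diff_left)
    then show "x \<in> E i" using f[OF i] by (simp add: cinner_self_eq_0)
  qed
qed (rule le[OF i])

section \<open>The Wold decomposition of one isometry\<close>

text \<open>Carrying the adjoint \<open>A\<close> as a parameter makes the powers of \<open>V\<close> with those of \<open>A\<close> another
  instance of the locale, so facts about \<open>V\<close> apply to all its powers.\<close>

locale hilbert_isometry =
  fixes V A :: "'a::complex_hilbert_space \<Rightarrow> 'a"
  assumes add: "V (x + y) = V x + V y"
    and scale: "V (c *\<^sub>C x) = c *\<^sub>C V x"
    and adjoint: "cinner (V x) y = cinner x (A y)"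
    and left_inverse: "A (V x) = x"
begin

lemma adjoint': "cinner (A x) y = cinner x (V y)"
  by (metis adjoint cinner_commute)

lemma cinner_preserving: "cinner (V x) (V y) = cinner x y"
  by (simp add: adjoint left_inverse)

lemma norm_preserving: "norm (V x) = norm x"
  using cinner_preserving[of x x] unfolding cinner_self of_real_eq_iff
  by (simp add: power2_eq_iff_nonneg)

lemma adjoint_add: "A (x + y) = A x + A y"
  by (rule cinner_ext) (simp add: adjoint' cinner_add_left)

lemma adjoint_scale: "A (c *\<^sub>C x) = c *\<^sub>C A x"
  by (rule cinner_ext) (simp add: adjoint' cinner_scaleC_left)

lemma diff: "V (x - y) = V x - V y"
  using add[of "x - y" y] by simp

lemma adjoint_diff: "A (x - y) = A x - A y"
  using adjoint_add[of "x - y" y] by simp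

lemma power: "hilbert_isometry (V ^^ m) (A ^^ m)"
proof (induction m)
  case 0
  show ?case by unfold_locales auto
next
  case (Suc m)
  then interpret p: hilbert_isometry "V ^^ m" "A ^^ m" .
  show ?case
    by unfold_locales
      (simp_all add: funpow_swap1[of A] p.add p.scale add scale adjoint p.adjoint left_inverse p.left_inverse
         flip: funpow_swap1[of V])
qed

text \<open>The orthogonal projection onto the range of \<open>V ^^ m\<close>.\<close>

definition range_proj :: "nat \<Rightarrow> 'a \<Rightarrow> 'a" where
  "range_proj m x = (V ^^ m) ((A ^^ m) x)"

text \<open>This is the intersection of the ranges of all powers of \<open>V\<close>.\<close>

definition unitary_part :: "'a set" where
  "unitary_part = {x. \<forall>m. range_proj m x = x}"

definition shift_part :: "'a set" where
  "shift_part = {x. (\<lambda>m. range_proj m x) \<longlonglongrightarrow> 0}"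

lemma range_proj_0 [simp]: "range_proj 0 x = x"
  by (simp add: range_proj_def)

lemma range_proj_Suc: "range_proj (Suc m) x = V (range_proj m (A x))"
  by (simp add: range_proj_def funpow_swap1)

lemma range_proj_add: "range_proj m (x + y) = range_proj m x + range_proj m y"
proof -
  interpret p: hilbert_isometry "V ^^ m" "A ^^ m" by (rule power)
  show ?thesis by (simp add: range_proj_def p.add p.adjoint_add)
qed

lemma range_proj_scale: "range_proj m (c *\<^sub>C x) = c *\<^sub>C range_proj m x"
proof -
  interpret p: hilbert_isometry "V ^^ m" "A ^^ m" by (rule power)
  show ?thesis by (simp add: range_proj_def p.scale p.adjoint_scale)
qed

lemma range_proj_diff: "range_proj m (x - y) = range_proj m x - range_proj m y"
  using range_proj_add[of m "x - y" y] by simp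

lemma range_proj_selfadjoint: "cinner (range_proj m x) y = cinner x (range_proj m y)"
proof -
  interpret p: hilbert_isometry "V ^^ m" "A ^^ m" by (rule power)
  show ?thesis by (simp add: range_proj_def p.adjoint p.adjoint')
qed

text \<open>The range of \<open>V ^^ n\<close> is contained in that of \<open>V ^^ m\<close>.\<close>

lemma range_proj_absorb:
  assumes "m \<le> n"
  shows "range_proj m (range_proj n x) = range_proj n x"
proof -
  interpret p: hilbert_isometry "V ^^ m" "A ^^ m" by (rule power)
  have "V ^^ n = V ^^ m \<circ> V ^^ (n - m)"
    using assms by (simp flip: funpow_add)
  then show ?thesis by (simp add: range_proj_def p.left_inverse)
qed

lemma norm_range_proj_diff:
  assumes "m \<le> n"
  shows "(norm (range_proj m x - range_proj n x))\<^sup>2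
           = (norm (range_proj m x))\<^sup>2 - (norm (range_proj n x))\<^sup>2"
proof -
  have "cinner (range_proj m x) (range_proj n x) = cinner (range_proj n x) (range_proj n x)"
    using assms by (simp add: range_proj_selfadjoint range_proj_absorb)
  then have "inner (range_proj m x) (range_proj n x) = (norm (range_proj n x))\<^sup>2"
    by (simp add: inner_eq_Re_cinner cinner_self)
  then show ?thesis
    by (simp add: power2_norm_eq_inner inner_diff inner_commute)
qed

lemma norm_range_proj_antimono:
  assumes "m \<le> n"
  shows "(norm (range_proj n x))\<^sup>2 \<le> (norm (range_proj m x))\<^sup>2"
  using norm_range_proj_diff[OF assms, of x] zero_le_power2[of "norm (range_proj m x - range_proj n x)"]
  by linarith

lemma bounded_linear_range_proj: "bounded_linear (range_proj m)"
proof (rule bounded_linear_intro[where K = 1])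
  show "norm (range_proj m x) \<le> norm x * 1" for x
    using norm_range_proj_antimono[of 0 m x] by simp
qed (simp_all add: range_proj_add range_proj_scale scaleR_scaleC)

lemma range_proj_commute:
  assumes "\<And>x. T (V x) = V (T x)" and "\<And>x. T (A x) = A (T x)"
  shows "range_proj m (T x) = T (range_proj m x)"
  by (induction m arbitrary: x) (simp_all add: range_proj_Suc assms flip: assms(2))

text \<open>The squared norms of the projections of \<open>x\<close> decrease, hence form a Cauchy sequence, and their
  differences are the squared distances of the projections.\<close>

lemma convergent_range_proj: "convergent (\<lambda>n. range_proj n x)"
proof -
  define a where "a n = (norm (range_proj n x))\<^sup>2" for n
  have "decseq a"
    by (auto simp: decseq_def a_def norm_range_proj_antimono simp del: power_mono_iff)
  then have "convergent a"
    by (rule decseq_convergent[where B = 0]) (auto simp: a_def convergent_def)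
  then have "Cauchy a" by (rule convergent_Cauchy)
  have "Cauchy (\<lambda>n. range_proj n x)"
  proof (rule metric_CauchyI)
    fix e :: real assume e: "0 < e"
    then obtain N where N: "\<And>m n. m \<ge> N \<Longrightarrow> n \<ge> N \<Longrightarrow> dist (a m) (a n) < e\<^sup>2"
      using metric_CauchyD[OF \<open>Cauchy a\<close>, of "e\<^sup>2"] by auto
    have le: "dist (range_proj m x) (range_proj n x) < e" if "m \<ge> N" "n \<ge> N" "m \<le> n" for m n
    proof -
      have "(norm (range_proj m x - range_proj n x))\<^sup>2 < e\<^sup>2"
        using N[OF that(1,2)] by (simp add: norm_range_proj_diff[OF that(3)] a_def dist_real_def)
      then show ?thesis using e by (simp add: dist_norm power_less_imp_less_base)
    qed
    show "\<exists>N. \<forall>m\<ge>N. \<forall>n\<ge>N. dist (range_proj m x) (range_proj n x) < e"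
      using le by (metis dist_commute nat_le_linear)
  qed
  then show ?thesis by (rule Cauchy_convergent)
qed

text \<open>The component in the unitary part is the limit of the projections of \<open>x\<close>.  Each projection of
  \<open>x\<close> stays in the invariant subspace \<open>M\<close>, so both components do; this relative form allows the
  decomposition to be applied inside a part of another isometry.\<close>

lemma wold_decomposition:
  assumes M: "closed_csubspace M" and inv: "V ` M \<subseteq> M" "A ` M \<subseteq> M" and x: "x \<in> M"
  obtains u s where "u \<in> M \<inter> unitary_part" "s \<in> M \<inter> shift_part" "x = u + s"
proof -
  obtain u where u: "(\<lambda>n. range_proj n x) \<longlonglongrightarrow> u"
    using convergent_range_proj convergent_def by blast
  have "y \<in> M \<Longrightarrow> range_proj n y \<in> M" for n y
    by (induction n arbitrary: y) (use inv in \<open>auto simp: range_proj_Suc\<close>)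
  then have uM: "u \<in> M"
    by (intro closed_csubspace_limit[OF M u]) (auto simp: x)
  have fixed: "range_proj m u = u" for m
  proof -
    have "(\<lambda>n. range_proj m (range_proj n x)) \<longlonglongrightarrow> range_proj m u"
      by (rule bounded_linear.tendsto[OF bounded_linear_range_proj u])
    moreover have "\<forall>\<^sub>F n in sequentially. range_proj m (range_proj n x) = range_proj n x"
      using eventually_ge_at_top[of m] by eventually_elim (rule range_proj_absorb)
    ultimately have "(\<lambda>n. range_proj n x) \<longlonglongrightarrow> range_proj m u"
      by (rule Lim_transform_eventually)
    then show ?thesis using u LIMSEQ_unique by blast
  qed
  have "(\<lambda>n. range_proj n x - u) \<longlonglongrightarrow> u - u"
    by (intro tendsto_intros u)
  then have "x - u \<in> shift_part"
    by (simp add: shift_part_def range_proj_diff fixed)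
  then show thesis
    using uM fixed closed_csubspace_diff[OF M x uM]
    by (intro that[of u "x - u"]) (auto simp: unitary_part_def)
qed

lemma unitary_part_orthogonal_shift_part: "corthogonal unitary_part shift_part"
  unfolding corthogonal_def
proof (intro ballI)
  fix x y assume x: "x \<in> unitary_part" and y: "y \<in> shift_part"
  have "cinner x (range_proj m y) = cinner x y" for m
    using x by (simp flip: range_proj_selfadjoint add: unitary_part_def)
  moreover have "(\<lambda>m. cinner x (range_proj m y)) \<longlonglongrightarrow> cinner x 0"
    using y by (intro tendsto_cinner_right) (simp add: shift_part_def)
  ultimately show "cinner x y = 0"
    by (simp add: LIMSEQ_const_iff)
qed

lemma closed_csubspace_unitary_part: "closed_csubspace unitary_part"
proof -
  have "complex_vector.subspace unitary_part"
    unfolding complex_vector.subspace_def unitary_part_def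
    using linear_0[OF bounded_linear.linear[OF bounded_linear_range_proj]]
    by (auto simp: range_proj_add range_proj_scale)
  moreover have "closed unitary_part"
    unfolding unitary_part_def Collect_all_eq
    by (intro closed_INT ballI closed_Collect_eq linear_continuous_on
        bounded_linear_range_proj continuous_on_id)
  ultimately show ?thesis by (simp add: closed_csubspace_def)
qed

lemma shift_part_eq_compl: "shift_part = corthogonal_compl unitary_part"
proof
  show "shift_part \<subseteq> corthogonal_compl unitary_part"
    using unitary_part_orthogonal_shift_part cinner_eq_0_commute
    by (auto simp: corthogonal_def corthogonal_compl_def)
  show "corthogonal_compl unitary_part \<subseteq> shift_part"
  proof
    fix x assume x: "x \<in> corthogonal_compl unitary_part"
    obtain u s where us: "u \<in> unitary_part" "s \<in> shift_part" "x = u + s"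
      using wold_decomposition[of UNIV x] by (auto simp: closed_csubspace_def)
    then have "cinner u u = cinner x u"
      using unitary_part_orthogonal_shift_part cinner_eq_0_commute
      by (auto simp: corthogonal_def cinner_add_left)
    then have "u = 0" using x us(1) by (auto simp: corthogonal_compl_def cinner_self_eq_0)
    then show "x \<in> shift_part" using us by simp
  qed
qed

lemma closed_csubspace_shift_part: "closed_csubspace shift_part"
  unfolding shift_part_eq_compl by (rule closed_csubspace_compl)

text \<open>\<open>V\<close> and \<open>A\<close> shift the index of the projections by one.  Invariance passes from the unitary part to
  its complement because \<open>V\<close> and \<open>A\<close> are adjoint to each other.\<close>

lemma parts_invariant:
  "V ` unitary_part \<subseteq> unitary_part" "A ` unitary_part \<subseteq> unitary_part"
  "V ` shift_part \<subseteq> shift_part" "A ` shift_part \<subseteq> shift_part"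
proof -
  have QV: "range_proj (Suc m) (V x) = V (range_proj m x)" for m x
    by (simp add: range_proj_Suc left_inverse)
  have AQ: "A (range_proj (Suc m) x) = range_proj m (A x)" for m x
    by (simp add: range_proj_Suc left_inverse)
  show V_unitary: "V ` unitary_part \<subseteq> unitary_part"
  proof safe
    fix x assume "x \<in> unitary_part"
    then have "range_proj m (V x) = V x" for m
      by (cases m) (auto simp: QV unitary_part_def)
    then show "V x \<in> unitary_part" by (simp add: unitary_part_def)
  qed
  show A_unitary: "A ` unitary_part \<subseteq> unitary_part"
    unfolding unitary_part_def by (auto simp flip: AQ)
  show "V ` shift_part \<subseteq> shift_part" "A ` shift_part \<subseteq> shift_part"
    using V_unitary A_unitary unfolding shift_part_eq_compl corthogonal_compl_def
    by (auto simp: adjoint adjoint')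
qed

lemma reduces_iff: "reduces M V \<longleftrightarrow> closed_csubspace M \<and> V ` M \<subseteq> M \<and> A ` M \<subseteq> M"
proof
  assume red: "reduces M V"
  then have M: "closed_csubspace M" by (simp add: reduces_def)
  have "A y \<in> M" if y: "y \<in> M" for y
  proof -
    obtain p where p: "p \<in> M" "A y - p \<in> corthogonal_compl M"
      using orthogonal_projection_exists[OF M] .
    define q where "q = A y - p"
    have "V q \<in> corthogonal_compl M" using p(2) red by (auto simp: reduces_def q_def)
    then have "cinner y (V q) = 0" using y cinner_eq_0_commute by (auto simp: corthogonal_compl_def)
    then have "cinner (A y) q = 0" by (simp add: adjoint')
    moreover have "cinner p q = 0"
      using p cinner_eq_0_commute by (auto simp: corthogonal_compl_def q_def)
    ultimately have "cinner q q = 0" by (simp add: q_def cinner_diff_left)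
    then show ?thesis using p(1) by (simp add: cinner_self_eq_0 q_def)
  qed
  then show "closed_csubspace M \<and> V ` M \<subseteq> M \<and> A ` M \<subseteq> M"
    using red by (auto simp: reduces_def)
next
  assume "closed_csubspace M \<and> V ` M \<subseteq> M \<and> A ` M \<subseteq> M"
  then show "reduces M V"
    by (auto simp: reduces_def corthogonal_compl_def adjoint)
qed

lemma reduces_Int: "reduces M V \<Longrightarrow> reduces N V \<Longrightarrow> reduces (M \<inter> N) V"
  unfolding reduces_iff using closed_csubspace_Int[of M N] by blast

lemma isometry_on_invariant: "V ` M \<subseteq> M \<Longrightarrow> isometry_on M V"
  unfolding isometry_on_def bounded_operator_on_def
  by (intro conjI exI[of _ 1]) (auto simp: add scale norm_preserving)

text \<open>The adjoint of the restriction is the restriction of \<open>A\<close>, so unitarity on \<open>M\<close> says that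
  \<open>V (A x) = x\<close> there; iterating this gives all projections.\<close>

lemma unitary_on_iff:
  assumes "reduces M V"
  shows "unitary_on M V \<longleftrightarrow> M \<subseteq> unitary_part"
proof -
  have M: "closed_csubspace M" "V ` M \<subseteq> M" "A ` M \<subseteq> M"
    using assms by (auto simp: reduces_iff)
  have adj: "adjoint_on M V y = A y" if "y \<in> M" for y
    using that M(3) by (intro adjoint_on_eqI M adjoint) auto
  have "unitary_on M V \<longleftrightarrow> (\<forall>x\<in>M. V (A x) = x)"
    using isometry_on_invariant[OF M(2)] M(2)
    by (auto simp: unitary_on_def isometry_on_def adj left_inverse)
  also have "\<dots> \<longleftrightarrow> M \<subseteq> unitary_part"
  proof
    assume *: "\<forall>x\<in>M. V (A x) = x"
    have "range_proj m x = x" if "x \<in> M" for m x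
      using that by (induction m arbitrary: x) (use * M(3) in \<open>auto simp: range_proj_Suc\<close>)
    then show "M \<subseteq> unitary_part" by (auto simp: unitary_part_def)
  next
    assume "M \<subseteq> unitary_part"
    then have "range_proj (Suc 0) x = x" if "x \<in> M" for x
      using that unfolding unitary_part_def by blast
    then show "\<forall>x\<in>M. V (A x) = x" by (simp add: range_proj_Suc)
  qed
  finally show ?thesis .
qed

text \<open>Cancelling \<open>V ^^ k\<close> leaves the inner product of a vector of the kernel of \<open>A\<close> with a vector in
  the range of \<open>V\<close>.\<close>

lemma kernel_adjoint_orthogonal:
  assumes "A w = 0" "k < l"
  shows "cinner ((V ^^ k) w) ((V ^^ l) z) = 0"
proof -
  interpret p: hilbert_isometry "V ^^ k" "A ^^ k" by (rule power)
  obtain d where l: "l = k + Suc d" using \<open>k < l\<close> less_iff_Suc_add by auto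
  have "cinner ((V ^^ k) w) ((V ^^ l) z) = cinner w (V ((V ^^ d) z))"
    using p.cinner_preserving[of w "V ((V ^^ d) z)"] unfolding l funpow_add by simp
  also have "\<dots> = 0" using assms(1) by (simp flip: adjoint')
  finally show ?thesis .
qed

text \<open>The wandering subspace is the part of the kernel of \<open>A\<close> in \<open>M\<close>.  The differences of consecutive
  projections of \<open>x\<close> lie in its images under the powers of \<open>V\<close>, and their partial sums telescope
  to \<open>x - range_proj n x\<close>.\<close>

lemma shift_on_if_subset:
  assumes red: "reduces M V" and sub: "M \<subseteq> shift_part"
  shows "shift_on M V"
proof -
  have M: "closed_csubspace M" "V ` M \<subseteq> M" "A ` M \<subseteq> M"
    using red by (auto simp: reduces_iff)
  have Vpow: "(V ^^ m) x \<in> M" and Apow: "(A ^^ m) x \<in> M" if "x \<in> M" for m x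
    using that by (induction m) (use M in auto)
  define W where "W = M \<inter> {w. A w = 0}"
  have "A w = 0 \<longleftrightarrow> (\<forall>z. cinner w (V z) = 0)" for w
    by (metis adjoint' cinner_self_eq_0 cinner_zero_left)
  then have "{w. A w = 0} = corthogonal_compl (range V)"
    by (auto simp: corthogonal_compl_def)
  then have W: "closed_csubspace W"
    unfolding W_def by (simp add: closed_csubspace_Int M closed_csubspace_compl)
  have orth_less: "cinner x y = 0" if "k < l" "x \<in> (V ^^ k) ` W" "y \<in> (V ^^ l) ` W" for k l x y
    using that kernel_adjoint_orthogonal by (auto simp: W_def)
  have orth: "cinner x y = 0" if "k \<noteq> l" "x \<in> (V ^^ k) ` W" "y \<in> (V ^^ l) ` W" for k l x y
    using that orth_less[of k l x y] orth_less[of l k y x] cinner_eq_0_commute[of x y]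
    by (cases "k < l") auto
  have series: "\<exists>f. (\<forall>m. f m \<in> (V ^^ m) ` W) \<and> (f has_sum x) UNIV" if x: "x \<in> M" for x
  proof -
    define f where "f m = range_proj m x - range_proj (Suc m) x" for m
    have f: "f m \<in> (V ^^ m) ` W" for m
    proof -
      interpret p: hilbert_isometry "V ^^ m" "A ^^ m" by (rule power)
      define y where "y = (A ^^ m) x"
      have "y \<in> M" by (simp add: y_def Apow x)
      then have "y - V (A y) \<in> W"
        using M by (auto simp: W_def adjoint_diff left_inverse intro!: closed_csubspace_diff)
      moreover have "f m = (V ^^ m) (y - V (A y))"
        by (simp add: f_def range_proj_def p.diff y_def funpow_swap1)
      ultimately show ?thesis by blast
    qed
    have "(\<Sum>m<n. f m) = x - range_proj n x" for n
      by (induction n) (simp_all add: f_def)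
    moreover have "(\<lambda>n. x - range_proj n x) \<longlonglongrightarrow> x - 0"
      using x sub by (intro tendsto_intros) (auto simp: shift_part_def)
    ultimately have "f sums x" by (simp add: sums_def)
    moreover have "inner (f i) (f j) = 0" if "i \<noteq> j" for i j
      using orth[OF that f f] by (simp add: inner_eq_Re_cinner)
    ultimately have "(f has_sum x) UNIV"
      by (intro orthogonal_series_has_sum) auto
    with f show ?thesis by blast
  qed
  have "M = {x. \<exists>f. (\<forall>m\<in>UNIV. f m \<in> (V ^^ m) ` W) \<and> (f has_sum x) UNIV}"
  proof safe
    fix x assume "x \<in> M"
    then show "\<exists>f. (\<forall>m\<in>UNIV. f m \<in> (V ^^ m) ` W) \<and> (f has_sum x) UNIV"
      using series by simp
  next
    fix x f assume f: "\<forall>m\<in>UNIV. f m \<in> (V ^^ m) ` W" "(f has_sum x) UNIV"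
    have "f m \<in> M" for m
    proof -
      obtain w where "w \<in> M" "f m = (V ^^ m) w" using f(1) by (auto simp: W_def)
      then show ?thesis using Vpow by simp
    qed
    then show "x \<in> M" by (intro closed_csubspace_has_sum[OF M(1) f(2)])
  qed
  moreover have "corthogonal ((V ^^ k) ` W) ((V ^^ l) ` W)" if "k \<noteq> l" for k l
    unfolding corthogonal_def using orth[OF that] by blast
  ultimately have "is_orthogonal_sum M UNIV (\<lambda>m. (V ^^ m) ` W)"
    unfolding is_orthogonal_sum_def by (intro conjI ballI impI)
  moreover have "W \<subseteq> M" by (simp add: W_def)
  ultimately show ?thesis
    unfolding shift_on_def using W isometry_on_invariant[OF M(2)] by (intro conjI exI[of _ W])
qed

text \<open>A wandering subspace \<open>W\<close> is annihilated by \<open>A\<close>: for \<open>w\<close> in \<open>W\<close>, the vector \<open>A w\<close> lies in \<open>M\<close>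
  but is orthogonal to every summand \<open>(V ^^ m) ` W\<close>, because \<open>w\<close> is orthogonal to the next one.
  Hence every summand is orthogonal to the ranges of the higher powers of \<open>V\<close>, in particular to the
  unitary part, and so is \<open>M\<close>.\<close>

lemma subset_if_shift_on:
  assumes red: "reduces M V" and shift: "shift_on M V"
  shows "M \<subseteq> shift_part"
proof
  fix x assume x: "x \<in> M"
  have AM: "A ` M \<subseteq> M" using red by (auto simp: reduces_iff)
  obtain W where W: "W \<subseteq> M" and sum: "is_orthogonal_sum M UNIV (\<lambda>m. (V ^^ m) ` W)"
    using shift unfolding shift_on_def by (elim conjE exE) (rule that)
  have expand: "\<exists>g. (\<forall>m. g m \<in> W) \<and> ((\<lambda>m. (V ^^ m) (g m)) has_sum y) UNIV" if "y \<in> M" for y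
  proof -
    obtain f where f: "\<And>m. f m \<in> (V ^^ m) ` W" "(f has_sum y) UNIV"
      using is_orthogonal_sum_expansion[OF sum \<open>y \<in> M\<close>] by blast
    have "\<forall>m. \<exists>w. w \<in> W \<and> f m = (V ^^ m) w" using f(1) by blast
    then obtain g where g: "\<And>m. g m \<in> W" "\<And>m. f m = (V ^^ m) (g m)" by metis
    then have "f = (\<lambda>m. (V ^^ m) (g m))" by auto
    then show ?thesis using f(2) g(1) by blast
  qed
  have kernel: "A w = 0" if w: "w \<in> W" for w
  proof -
    have "A w \<in> M" using w W AM by auto
    then obtain g where g: "\<forall>m. g m \<in> W" "((\<lambda>m. (V ^^ m) (g m)) has_sum A w) UNIV"
      using expand by blast
    have "cinner ((V ^^ m) (g m)) (A w) = 0" for m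
    proof -
      have "corthogonal ((V ^^ Suc m) ` W) ((V ^^ 0) ` W)"
        by (rule is_orthogonal_sum_orthogonal[OF sum]) auto
      then have "cinner ((V ^^ Suc m) (g m)) w = 0"
        using g(1) w by (auto simp: corthogonal_def)
      then show ?thesis by (simp flip: adjoint)
    qed
    then have "((\<lambda>m. 0) has_sum cinner (A w) (A w)) (UNIV :: nat set)"
      using has_sum_cinner_left[OF g(2), of "A w"] by simp
    then show ?thesis
      using has_sum_unique has_sum_0_simp cinner_self_eq_0 by metis
  qed
  obtain g where g: "\<forall>m. g m \<in> W" "((\<lambda>m. (V ^^ m) (g m)) has_sum x) UNIV"
    using expand x by blast
  have "cinner x u = 0" if u: "u \<in> unitary_part" for u
  proof -
    have "cinner ((V ^^ m) (g m)) u = 0" for m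
    proof -
      have "u = (V ^^ Suc m) ((A ^^ Suc m) u)"
        using u by (simp only: unitary_part_def range_proj_def mem_Collect_eq)
      moreover have "cinner ((V ^^ m) (g m)) ((V ^^ Suc m) ((A ^^ Suc m) u)) = 0"
        by (rule kernel_adjoint_orthogonal) (use kernel g(1) in auto)
      ultimately show ?thesis by metis
    qed
    then have "((\<lambda>m. 0) has_sum cinner x u) (UNIV :: nat set)"
      using has_sum_cinner_left[OF g(2), of u] by simp
    then show ?thesis using has_sum_unique has_sum_0_simp by metis
  qed
  then show "x \<in> shift_part"
    by (auto simp: shift_part_eq_compl corthogonal_compl_def)
qed

lemma shift_on_iff: "reduces M V \<Longrightarrow> shift_on M V \<longleftrightarrow> M \<subseteq> shift_part"
  using shift_on_if_subset subset_if_shift_on by blast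

section \<open>Twisted commutation\<close>

text \<open>Here \<open>U\<close> is the twist and \<open>U'\<close> its inverse.  In each induction step, passing \<open>A\<close> produces
  \<open>U'\<close> and passing \<open>V\<close> produces \<open>U\<close>; since \<open>U'\<close> commutes with \<open>V\<close> and \<open>A\<close>, the two meet and cancel.\<close>

lemma range_proj_twisted_commute:
  assumes VT: "\<And>x. V (T x) = U (T (V x))" and AT: "\<And>x. A (T x) = U' (T (A x))"
    and VU': "\<And>x. V (U' x) = U' (V x)" and AU': "\<And>x. A (U' x) = U' (A x)"
    and U'U: "\<And>x. U' (U x) = x"
  shows "range_proj m (T x) = T (range_proj m x)"
proof (induction m arbitrary: x)
  case (Suc m)
  have "range_proj (Suc m) (T x) = V (range_proj m (U' (T (A x))))"
    by (simp add: range_proj_Suc AT)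
  also have "\<dots> = V (U' (T (range_proj m (A x))))"
    by (simp add: range_proj_commute[of U'] VU' AU' Suc.IH)
  also have "\<dots> = T (range_proj (Suc m) x)"
    by (simp add: VU' VT U'U range_proj_Suc)
  finally show ?case .
qed simp

text \<open>An operator that commutes with the self-adjoint projections does so together with its adjoint,
  and both then preserve the unitary part and its complement.\<close>

lemma parts_invariant_twisted:
  assumes adj: "\<And>x y. cinner (T x) y = cinner x (B y)"
    and comm: "\<And>m x. range_proj m (T x) = T (range_proj m x)"
  shows "T ` unitary_part \<subseteq> unitary_part" "B ` unitary_part \<subseteq> unitary_part"
    "T ` shift_part \<subseteq> shift_part" "B ` shift_part \<subseteq> shift_part"
proof -
  have adj': "cinner (B x) y = cinner x (T y)" for x y
    by (metis adj cinner_commute)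
  have commB: "range_proj m (B x) = B (range_proj m x)" for m x
    by (rule cinner_ext) (simp add: range_proj_selfadjoint adj' comm)
  show TU: "T ` unitary_part \<subseteq> unitary_part" and BU: "B ` unitary_part \<subseteq> unitary_part"
    by (auto simp: unitary_part_def comm commB)
  show "T ` shift_part \<subseteq> shift_part" "B ` shift_part \<subseteq> shift_part"
    using TU BU unfolding shift_part_eq_compl corthogonal_compl_def by (auto simp: adj adj')
qed

end

text \<open>By polarization, preserving norms amounts to preserving inner products.\<close>

lemma hilbert_isometry_cadjoint:
  fixes V :: "'a::complex_hilbert_space \<Rightarrow> 'a"
  assumes "isometry_on UNIV V"
  shows "hilbert_isometry V (cadjoint V)"
proof
  have V: "bounded_operator_on UNIV V" and norm: "norm (V x) = norm x" for x
    using assms by (auto simp: isometry_on_def)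
  show add: "V (x + y) = V x + V y" and scale: "V (c *\<^sub>C x) = c *\<^sub>C V x" for x y c
    using V by (auto simp: bounded_operator_on_def)
  show adj: "cinner (V x) y = cinner x (cadjoint V y)" for x y
    by (rule cinner_cadjoint[OF V])
  have "inner (V x) (V y) = inner x y" for x y
    by (simp add: dot_norm norm flip: add)
  then have "cinner (V x) (V y) = cinner x y" for x y
    by (simp add: cinner_eq_Complex flip: scale)
  then show "cadjoint V (V x) = x" for x
    by (intro cinner_ext_right) (simp flip: adj)
qed

text \<open>The second equation is the first one for the exchanged pair, whose twist is the adjoint of \<open>U\<close>.
  The relations needed there are obtained from the given ones by taking adjoints and using that
  \<open>U\<close> is invertible.\<close>

lemma doubly_twisted_range_proj_commute:
  fixes V1 V2 :: "'a::complex_hilbert_space \<Rightarrow> 'a"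
  assumes iso1: "isometry_on UNIV V1" and iso2: "isometry_on UNIV V2" and tw: "doubly_twisted V1 V2"
  shows "hilbert_isometry.range_proj V1 (cadjoint V1) m (V2 x)
           = V2 (hilbert_isometry.range_proj V1 (cadjoint V1) m x)"
    and "hilbert_isometry.range_proj V2 (cadjoint V2) m (V1 x)
           = V1 (hilbert_isometry.range_proj V2 (cadjoint V2) m x)"
proof -
  define A1 where "A1 = cadjoint V1"
  define A2 where "A2 = cadjoint V2"
  interpret a: hilbert_isometry V1 A1
    unfolding A1_def by (rule hilbert_isometry_cadjoint[OF iso1])
  interpret b: hilbert_isometry V2 A2
    unfolding A2_def by (rule hilbert_isometry_cadjoint[OF iso2])
  obtain U where "unitary_on UNIV U"
    and *: "V1 \<circ> V2 = U \<circ> V2 \<circ> V1" "A1 \<circ> V2 = cadjoint U \<circ> V2 \<circ> A1"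
      "V1 \<circ> U = U \<circ> V1" "V2 \<circ> U = U \<circ> V2"
    using tw unfolding doubly_twisted_def A1_def[symmetric] by (elim conjE exE) (rule that)
  define U' where "U' = cadjoint U"
  have bU: "bounded_operator_on UNIV U" and U'U: "\<And>x. U' (U x) = x" and UU': "\<And>x. U (U' x) = x"
    using \<open>unitary_on UNIV U\<close> by (auto simp: unitary_on_def U'_def)
  have adjU: "cinner (U x) y = cinner x (U' y)" for x y
    unfolding U'_def by (rule cinner_cadjoint[OF bU])
  have adjU': "cinner (U' x) y = cinner x (U y)" for x y
    by (metis adjU cinner_commute)
  have V12: "V1 (V2 x) = U (V2 (V1 x))" and A1V2: "A1 (V2 x) = U' (V2 (A1 x))"
    and V1U: "V1 (U x) = U (V1 x)" and V2U: "V2 (U x) = U (V2 x)" for x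
    using *[THEN fun_cong, of x] by (auto simp: U'_def)
  have V1U': "V1 (U' x) = U' (V1 x)" and V2U': "V2 (U' x) = U' (V2 x)" for x
    using V1U[of "U' x"] V2U[of "U' x"] by (simp_all add: UU' U'U)
  have A1U': "A1 (U' x) = U' (A1 x)" for x
    by (rule adjoint_commute[OF a.adjoint adjU V1U])
  have A2U: "A2 (U x) = U (A2 x)" for x
    by (rule adjoint_commute[OF b.adjoint adjU' V2U'])
  have V21: "V2 (V1 x) = U' (V1 (V2 x))" for x
    by (simp add: V12 U'U)
  have A2V1: "A2 (V1 x) = U (V1 (A2 x))" for x
  proof (rule cinner_ext)
    fix z
    have "cinner (A2 (V1 x)) z = cinner x (U' (V2 (A1 z)))"
      by (simp add: b.adjoint' a.adjoint A1V2)
    also have "\<dots> = cinner (V1 (A2 (U x))) z"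
      by (simp add: a.adjoint b.adjoint' adjU)
    finally show "cinner (A2 (V1 x)) z = cinner (U (V1 (A2 x))) z"
      by (simp add: A2U V1U)
  qed
  show "hilbert_isometry.range_proj V1 (cadjoint V1) m (V2 x)
      = V2 (hilbert_isometry.range_proj V1 (cadjoint V1) m x)"
    unfolding A1_def[symmetric]
    by (rule a.range_proj_twisted_commute[OF V12 A1V2 V1U' A1U' U'U])
  show "hilbert_isometry.range_proj V2 (cadjoint V2) m (V1 x)
      = V1 (hilbert_isometry.range_proj V2 (cadjoint V2) m x)"
    unfolding A2_def[symmetric]
    by (rule b.range_proj_twisted_commute[OF V21 A2V1 V2U A2U UU'])
qed

section \<open>The four-part decomposition\<close>

lemma orthogonal_sum_four:
  fixes A B C D :: "'a::complex_inner set"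
  assumes orth: "corthogonal A B" "corthogonal A C" "corthogonal A D" "corthogonal B C"
    "corthogonal B D" "corthogonal C D"
    and dec: "\<And>x. \<exists>a\<in>A. \<exists>b\<in>B. \<exists>c\<in>C. \<exists>d\<in>D. x = a + b + c + d"
  shows "is_orthogonal_sum UNIV {..<4::nat} (\<lambda>i. [A, B, C, D] ! i)"
proof -
  have index: "i \<in> {0, 1, 2, 3}" if "i \<in> {..<4}" for i :: nat
    using that by auto
  have sym: "corthogonal N M" if "corthogonal M N" for M N :: "'a set"
    using that cinner_eq_0_commute unfolding corthogonal_def by blast
  have "corthogonal ([A, B, C, D] ! i) ([A, B, C, D] ! j)"
    if "i \<in> {..<4}" "j \<in> {..<4}" "i \<noteq> j" for i j
    using index[OF that(1)] index[OF that(2)] that(3)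
    by (elim insertE emptyE) (simp_all add: orth orth[THEN sym])
  moreover have "\<exists>f. (\<forall>i\<in>{..<4::nat}. f i \<in> [A, B, C, D] ! i) \<and> (f has_sum x) {..<4}" for x
  proof -
    obtain a b c d where mem: "a \<in> A" "b \<in> B" "c \<in> C" "d \<in> D" and x: "x = a + b + c + d"
      using dec by blast
    have "[a, b, c, d] ! i \<in> [A, B, C, D] ! i" if "i \<in> {..<4}" for i
      using index[OF that] by (elim insertE emptyE) (simp_all add: mem)
    moreover have "((\<lambda>i. [a, b, c, d] ! i) has_sum x) {..<4}"
      by (rule has_sum_finiteI) (simp_all add: x numeral_eq_Suc)
    ultimately show ?thesis by blast
  qed
  then have "UNIV = {x. \<exists>f. (\<forall>i\<in>{..<4::nat}. f i \<in> [A, B, C, D] ! i) \<and> (f has_sum x) {..<4}}"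
    by (intro equalityI subsetI CollectI UNIV_I)
  ultimately show ?thesis
    unfolding is_orthogonal_sum_def by (intro conjI ballI impI)
qed

theorem theorem3p15:
  fixes V1 V2 :: "'a::complex_hilbert_space \<Rightarrow> 'a"
  assumes "separable_space (euclidean :: 'a topology)"
    and "isometry_on UNIV V1" and "isometry_on UNIV V2"
    and "doubly_twisted V1 V2"
  shows "\<exists>!H. case H of (Huu, Hus, Hsu, Hss) \<Rightarrow>
           is_orthogonal_sum UNIV {..<4::nat} (\<lambda>i. [Huu, Hus, Hsu, Hss] ! i) \<and>
           (\<forall>M\<in>{Huu, Hus, Hsu, Hss}. reduces M V1 \<and> reduces M V2) \<and>
           (unitary_on Huu V1 \<and> unitary_on Huu V2) \<and>
           (unitary_on Hus V1 \<and> shift_on Hus V2) \<and>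
           (shift_on Hsu V1 \<and> unitary_on Hsu V2) \<and>
           (shift_on Hss V1 \<and> shift_on Hss V2)" (is "\<exists>!H. ?P H")
proof -
  interpret a: hilbert_isometry V1 "cadjoint V1" by (rule hilbert_isometry_cadjoint[OF assms(2)])
  interpret b: hilbert_isometry V2 "cadjoint V2" by (rule hilbert_isometry_cadjoint[OF assms(3)])
  note comm = doubly_twisted_range_proj_commute[OF assms(2-4)]
  note inv1 = a.parts_invariant b.parts_invariant_twisted[OF a.adjoint comm(2)]
  note inv2 = b.parts_invariant a.parts_invariant_twisted[OF b.adjoint comm(1)]
  note closed = a.closed_csubspace_unitary_part a.closed_csubspace_shift_part
    b.closed_csubspace_unitary_part b.closed_csubspace_shift_part
  define Huu where "Huu = a.unitary_part \<inter> b.unitary_part"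
  define Hus where "Hus = a.unitary_part \<inter> b.shift_part"
  define Hsu where "Hsu = a.shift_part \<inter> b.unitary_part"
  define Hss where "Hss = a.shift_part \<inter> b.shift_part"
  note H_defs = Huu_def Hus_def Hsu_def Hss_def
  have cl: "closed_csubspace M" if "M \<in> {Huu, Hus, Hsu, Hss}" for M
    using that closed_csubspace_Int closed by (auto simp: H_defs)
  have red: "reduces M V1 \<and> reduces M V2" if "M \<in> {Huu, Hus, Hsu, Hss}" for M
  proof -
    have parts: "reduces a.unitary_part V1" "reduces a.shift_part V1"
      "reduces b.unitary_part V1" "reduces b.shift_part V1"
      "reduces a.unitary_part V2" "reduces a.shift_part V2"
      "reduces b.unitary_part V2" "reduces b.shift_part V2"
      unfolding a.reduces_iff b.reduces_iff by (intro conjI closed inv1 inv2)+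
    from that show ?thesis
      unfolding H_defs by (elim insertE emptyE) (simp_all only: a.reduces_Int b.reduces_Int parts)
  qed
  have orth: "corthogonal a.unitary_part a.shift_part" "corthogonal b.unitary_part b.shift_part"
    by (rule a.unitary_part_orthogonal_shift_part b.unitary_part_orthogonal_shift_part)+
  have sum: "is_orthogonal_sum UNIV {..<4::nat} (\<lambda>i. [Huu, Hus, Hsu, Hss] ! i)"
  proof (rule orthogonal_sum_four)
    show "corthogonal Huu Hus" "corthogonal Huu Hsu" "corthogonal Huu Hss"
      "corthogonal Hsu Hss" "corthogonal Hus Hss" "corthogonal Hus Hsu"
      using orth by (auto simp: H_defs corthogonal_def)
    fix x
    obtain u s where us: "u \<in> a.unitary_part" "s \<in> a.shift_part" "x = u + s"
      using a.wold_decomposition[of UNIV x] by (auto simp: closed_csubspace_def)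
    obtain uu us where u: "uu \<in> Huu" "us \<in> Hus" "u = uu + us"
      using b.wold_decomposition[OF closed(1) inv2(5,6) us(1)] by (auto simp: H_defs)
    obtain su ss where s: "su \<in> Hsu" "ss \<in> Hss" "s = su + ss"
      using b.wold_decomposition[OF closed(2) inv2(7,8) us(2)] by (auto simp: H_defs)
    show "\<exists>a\<in>Huu. \<exists>b\<in>Hus. \<exists>c\<in>Hsu. \<exists>d\<in>Hss. x = a + b + c + d"
      using u s us(3) by (metis add.assoc)
  qed
  show ?thesis
  proof (rule ex1I[of _ "(Huu, Hus, Hsu, Hss)"])
    have unitary_iff: "unitary_on M V1 \<longleftrightarrow> M \<subseteq> a.unitary_part" "unitary_on M V2 \<longleftrightarrow> M \<subseteq> b.unitary_part"
      and shift_iff: "shift_on M V1 \<longleftrightarrow> M \<subseteq> a.shift_part" "shift_on M V2 \<longleftrightarrow> M \<subseteq> b.shift_part"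
      if "M \<in> {Huu, Hus, Hsu, Hss}" for M
      using red[OF that] a.unitary_on_iff b.unitary_on_iff a.shift_on_iff b.shift_on_iff by simp_all
    have ops: "unitary_on Huu V1" "unitary_on Huu V2" "unitary_on Hus V1" "shift_on Hus V2"
      "shift_on Hsu V1" "unitary_on Hsu V2" "shift_on Hss V1" "shift_on Hss V2"
      by (simp_all add: unitary_iff shift_iff) (simp_all add: H_defs)
    show "?P (Huu, Hus, Hsu, Hss)"
      unfolding prod.case by (intro conjI ballI sum ops conjunct1[OF red] conjunct2[OF red])
  next
    fix H assume P: "?P H"
    obtain A B C D where H: "H = (A, B, C, D)" by (cases H) auto
    note P' = P[unfolded H prod.case]
    have sumH: "is_orthogonal_sum UNIV {..<4::nat} (\<lambda>i. [A, B, C, D] ! i)"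
      by (rule conjunct1[OF P'])
    have redH: "reduces M V1" "reduces M V2" if "M \<in> {A, B, C, D}" for M
      using bspec[OF conjunct1[OF conjunct2[OF P']] that] by simp_all
    have opsH: "unitary_on A V1" "unitary_on A V2" "unitary_on B V1" "shift_on B V2"
      "shift_on C V1" "unitary_on C V2" "shift_on D V1" "shift_on D V2"
      using conjunct2[OF conjunct2[OF P']] by simp_all
    have sub: "A \<subseteq> Huu" "B \<subseteq> Hus" "C \<subseteq> Hsu" "D \<subseteq> Hss"
      using opsH redH a.unitary_on_iff b.unitary_on_iff a.shift_on_iff b.shift_on_iff
      by (simp_all add: H_defs)
    have "[A, B, C, D] ! i = [Huu, Hus, Hsu, Hss] ! i" if "i \<in> {..<4}" for i
    proof (rule orthogonal_sum_eq_of_subset[OF sumH sum _ _ that])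
      fix j :: nat assume "j \<in> {..<4}"
      then have j: "j \<in> {0, 1, 2, 3}" by auto
      then show "[A, B, C, D] ! j \<subseteq> [Huu, Hus, Hsu, Hss] ! j"
        by (elim insertE emptyE) (simp_all add: sub)
      show "closed_csubspace ([Huu, Hus, Hsu, Hss] ! j)"
        using j by (elim insertE emptyE) (simp_all add: cl)
    qed
    from this[of 0] this[of 1] this[of 2] this[of 3]
    show "H = (Huu, Hus, Hsu, Hss)" by (simp add: H)
  qed
qed

end
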